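(* Let $G=(V,E)$ be a finite directed graph in which every edge $e\in E$ is assigned a length $\mu_e\in[0,+\infty]$, and let $\mu(\cdot,\cdot)$ denote the bridge distance. Then for all $a,b,c\in V$ the metric inequality $$\mu(a,b)\le \mu(a,c)+\mu(c,b)$$ holds, and it becomes an equality whenever every $(a,b)$-path contains the vertex $c$.
   Context: Directed graphs have no loops; parallel edges (directed similarly or oppositely) are allowed. An $(a,b)$-path is a directed path (without repeated vertices) from $a$ to $b$ using edges of $E$. An edge $e\in E$ is called an $(a,b)$-bridge if it belongs to every $(a,b)$-path. The bridge distance $\mu(a,b)\in[0,+\infty]$ is defined as follows: $\mu(a,b)=+\infty$ if $G$ has no $(a,b)$-path; otherwise $\mu(a,b)=\sum_e \mu_e$, the sum being over all $(a,b)$-bridges $e$. In particular $\mu(a,b)=0$ if $(a,b)$-paths exist but there are no $(a,b)$-bridges. For $a=b$ the only $(a,a)$-path is the trivial one with no edges, so $\mu(a,a)=0$. Arithmetic is in $[0,+\infty]$. *)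

theory Defs
  imports
    "Graph_Theory.Arc_Walk"
    "HOL-Library.Extended_Nonnegative_Real"
begin

context pre_digraph
begin

text \<open>
  A path from \<open>a\<close> to \<open>b\<close> is \<^const>\<open>apath\<close>: a directed arc walk whose vertex sequence has no
  repetitions, so the only path from \<open>a\<close> to \<open>a\<close> is the empty one. Paths are lists of arcs, not of
  vertices, so that parallel arcs give different paths.
\<close>

definition bridges :: "'a \<Rightarrow> 'a \<Rightarrow> 'b set" where
  "bridges a b = {e \<in> arcs G. \<forall>p. apath a p b \<longrightarrow> e \<in> set p}"

definition bridge_dist :: "('b \<Rightarrow> ennreal) \<Rightarrow> 'a \<Rightarrow> 'a \<Rightarrow> ennreal" where
  "bridge_dist \<mu> a b =
     (if \<exists>p. apath a p b then \<Sum>e\<in>bridges a b. \<mu> e else \<infinity>)"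

end

end

theory Submission
  imports Defs
begin

text \<open>An (a,c)-path followed by a (c,b)-path is a walk that contains an (a,b)-path. Hence an
  arc avoided by a path of each kind is no (a,b)-bridge, so every (a,b)-bridge is a bridge for (a,c)
  or (c,b) (\<open>bridges_subset_Un\<close>); summing lengths gives the inequality. If c lies on
  every (a,b)-path, splitting these paths at c gives the reverse inclusion
  (\<open>bridges_eq_Un\<close>). If moreover such a path exists, the two bridge sets are disjoint
  (\<open>bridges_disjoint\<close>), so the sums add up exactly. Missing paths only produce infinite
  distances.\<close>

context wf_digraph
begin

lemma apath_split_at:
  assumes "apath a p b" and "c \<in> set (awalk_verts a p)"
  obtains q r where "p = q @ r" and "apath a q c" and "apath c r b"
proof -
  obtain q r where qr: "p = q @ r" "awalk a q c" "awalk c r b"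
    using awalk_decomp[OF awalkI_apath[OF assms(1)] assms(2)] by blast
  \<comment> \<open>\<open>apath_append_iff\<close> names the junction \<open>awlast a q\<close>;
    identifying it with \<open>c\<close> turns both walks into paths.\<close>
  then have "awlast a q = c"
    by blast
  then show thesis
    using assms(1) qr(1) that by (auto simp: apath_append_iff)
qed

lemma bridges_subset_Un:
  "bridges a b \<subseteq> bridges a c \<union> bridges c b"
proof
  fix e assume e: "e \<in> bridges a b"
  have "e \<in> set p \<union> set q" if "apath a p c" "apath c q b" for p q
  proof -
    have walk: "awalk a (p @ q) b"
      using that by (blast intro: awalk_appendI awalkI_apath)
    then have "e \<in> set (awalk_to_apath (p @ q))"
      using e apath_awalk_to_apath unfolding bridges_def by blast
    then show ?thesis
      using awalk_to_apath_subset[OF walk] unfolding set_append by blast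
  qed
  \<comment> \<open>Otherwise some \<open>p\<close> and some \<open>q\<close> would both avoid
    \<open>e\<close>. If a pair has no path, all arcs are vacuously its bridges, so connectivity
    need not be assumed.\<close>
  then show "e \<in> bridges a c \<union> bridges c b"
    using e unfolding bridges_def by blast
qed

lemma bridges_eq_Un:
  assumes "\<And>p. apath a p b \<Longrightarrow> c \<in> set (awalk_verts a p)"
  shows "bridges a b = bridges a c \<union> bridges c b"
proof
  show "bridges a c \<union> bridges c b \<subseteq> bridges a b"
  proof
    fix e assume e: "e \<in> bridges a c \<union> bridges c b"
    have "e \<in> set p" if p: "apath a p b" for p
    proof -
      obtain q r where "p = q @ r" "apath a q c" "apath c r b"
        using p assms[OF p] by (rule apath_split_at)
      then show ?thesis
        using e by (auto simp: bridges_def)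
    qed
    then show "e \<in> bridges a b"
      using e by (auto simp: bridges_def)
  qed
qed (rule bridges_subset_Un)

text \<open>A common bridge would lie on both halves of \<open>p\<close>, hence occur twice in
  \<open>p\<close>, whereas a path, having no repeated vertex, repeats no arc.\<close>

lemma bridges_disjoint:
  assumes "apath a p b" and "c \<in> set (awalk_verts a p)"
  shows "bridges a c \<inter> bridges c b = {}"
proof -
  obtain q r where "p = q @ r" "apath a q c" "apath c r b"
    using assms by (rule apath_split_at)
  moreover have "distinct p"
    using assms(1) by (auto simp: apath_def intro: distinct_verts_imp_distinct)
  ultimately show ?thesis
    by (auto simp: bridges_def)
qed

end

lemma (in fin_digraph) finite_bridges: "finite (bridges a b)"
  by (simp add: bridges_def)

lemma (in fin_digraph) bridge_dist_triangle:
  "bridge_dist \<mu> a b \<le> bridge_dist \<mu> a c + bridge_dist \<mu> c b"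
proof (cases "(\<exists>p. apath a p c) \<and> (\<exists>q. apath c q b)")
  case True
  then have "\<exists>p. apath a p b"
    by (meson apath_awalk_to_apath awalk_appendI awalkI_apath)
  moreover have "sum \<mu> (bridges a b) \<le> sum \<mu> (bridges a c) + sum \<mu> (bridges c b)"
  proof -
    have "sum \<mu> (bridges a b) \<le> sum \<mu> (bridges a c \<union> bridges c b)"
      by (intro sum_mono2 bridges_subset_Un) (auto simp: finite_bridges)
    \<comment> \<open>The bridge sets may overlap; adding the nonnegative sum over the intersection
      allows inclusion-exclusion without subtraction.\<close>
    also have "\<dots> \<le> sum \<mu> (bridges a c \<union> bridges c b) + sum \<mu> (bridges a c \<inter> bridges c b)"
      by simp
    also have "\<dots> = sum \<mu> (bridges a c) + sum \<mu> (bridges c b)"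
      by (intro sum.union_inter finite_bridges)
    finally show ?thesis .
  qed
  ultimately show ?thesis
    using True by (simp add: bridge_dist_def)
\<comment> \<open>With one of the two paths missing, the right-hand side is infinite.\<close>
qed (auto simp: bridge_dist_def)

lemma (in fin_digraph) bridge_dist_eq_add:
  assumes "\<And>p. apath a p b \<Longrightarrow> c \<in> set (awalk_verts a p)"
  shows "bridge_dist \<mu> a b = bridge_dist \<mu> a c + bridge_dist \<mu> c b"
proof (cases "\<exists>p. apath a p b")
  case True
  then obtain p where p: "apath a p b" ..
  obtain q r where "apath a q c" "apath c r b"
    using p assms[OF p] by (rule apath_split_at)
  moreover have "sum \<mu> (bridges a b) = sum \<mu> (bridges a c) + sum \<mu> (bridges c b)"
    using bridges_eq_Un[of a b c, OF assms] bridges_disjoint[OF p assms[OF p]]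
    by (simp add: sum.union_disjoint finite_bridges)
  ultimately show ?thesis
    using p by (auto simp: bridge_dist_def)
next
  case False
  then have "bridge_dist \<mu> a b = top"
    by (simp add: bridge_dist_def)
  then show ?thesis
    \<comment> \<open>The left-hand side is infinite, so the inequality forces the right-hand side
      to be infinite too.\<close>
    using bridge_dist_triangle[of \<mu> a b c] by (metis top_unique)
qed

theorem proposition3:
  fixes G :: "('a, 'b) pre_digraph"
    and \<mu> :: "'b \<Rightarrow> ennreal"
    and a b c :: 'a
  assumes "fin_digraph G" and "loopfree_digraph G"
    and "a \<in> verts G" and "b \<in> verts G" and "c \<in> verts G"
  shows "pre_digraph.bridge_dist G \<mu> a b
           \<le> pre_digraph.bridge_dist G \<mu> a c + pre_digraph.bridge_dist G \<mu> c b \<and>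
         ((\<forall>p. pre_digraph.apath G a p b \<longrightarrow> c \<in> set (pre_digraph.awalk_verts G a p)) \<longrightarrow>
          pre_digraph.bridge_dist G \<mu> a b
            = pre_digraph.bridge_dist G \<mu> a c + pre_digraph.bridge_dist G \<mu> c b)"
  using fin_digraph.bridge_dist_triangle[OF assms(1)] fin_digraph.bridge_dist_eq_add[OF assms(1)]
  by blast

end
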